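(* Let $n\geqslant 3$ be an integer, let $A_1,\ldots,A_n$ be Hermitian positive semidefinite complex matrices of the same size, and let $p\geqslant 1$ be an integer. For $1\leqslant k\leqslant n$ put $$S_{k,[n]}^p := \sum_{I\subseteq\{1,\ldots,n\},\ |I|=k}\Bigl(\sum_{i\in I}A_i\Bigr)^{\otimes p}.$$ Then, in the Löwner order, $$S_{n,[n]}^p + S_{n-2,[n]}^p + S_{n-4,[n]}^p+\cdots \ \geqslant\ S_{n-1,[n]}^p + S_{n-3,[n]}^p + S_{n-5,[n]}^p+\cdots,$$ where on each side the sum runs over all first indices $k\geqslant 1$ of the indicated parity (that is, $k\equiv n \pmod 2$ with $1\leqslant k\leqslant n$ on the left, and $k\equiv n-1\pmod 2$ with $1\leqslant k\leqslant n-1$ on the right).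
   Context: For a matrix $A$, $A^{\otimes p}=A\otimes\cdots\otimes A$ ($p$ factors) is the Kronecker (tensor) power. For Hermitian $X,Y$ of the same size, $X\geqslant Y$ (Löwner order) means that $X-Y$ is positive semidefinite. *)

theory Defs
  imports "Jordan_Normal_Form.Schur_Decomposition"
begin

definition hermitian_mat :: "complex mat \<Rightarrow> bool" where
  "hermitian_mat A \<longleftrightarrow> square_mat A \<and> mat_adjoint A = A"

text \<open>The order on complex numbers is the one with \<open>0 \<le> z\<close> iff \<open>z\<close> is real and nonnegative;
  \<open>(A *\<^sub>v v) \<bullet>c v\<close> is the quadratic form \<open>v\<^sup>* A v\<close>.\<close>

definition psd_mat :: "complex mat \<Rightarrow> bool" where
  "psd_mat A \<longleftrightarrow> hermitian_mat A \<and> (\<forall>v \<in> carrier_vec (dim_row A). 0 \<le> (A *\<^sub>v v) \<bullet>c v)"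

text \<open>The size and Hermitian conditions are part of the relation because matrix subtraction
  is total, even for matrices of different sizes.\<close>

definition loewner_ge :: "complex mat \<Rightarrow> complex mat \<Rightarrow> bool" where
  "loewner_ge X Y \<longleftrightarrow> hermitian_mat X \<and> hermitian_mat Y \<and> dim_row X = dim_row Y \<and> psd_mat (X - Y)"

text \<open>Row index \<open>r\<close> of the product stands for the pair
  \<open>(r div dim_row B, r mod dim_row B)\<close> (first factor major), and likewise for columns.\<close>

definition kronecker :: "complex mat \<Rightarrow> complex mat \<Rightarrow> complex mat" where
  "kronecker A B = mat (dim_row A * dim_row B) (dim_col A * dim_col B)
     (\<lambda>(r, c). A $$ (r div dim_row B, c div dim_col B) * B $$ (r mod dim_row B, c mod dim_col B))"

primrec kronecker_power :: "complex mat \<Rightarrow> nat \<Rightarrow> complex mat" where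
  "kronecker_power A 0 = 1\<^sub>m 1"
| "kronecker_power A (Suc p) = kronecker A (kronecker_power A p)"

text \<open>The type \<open>complex mat\<close> carries no global zero, so finite sums are taken in the module of
  matrices of size \<open>d\<close>, with the usual matrix addition.\<close>

definition mat_sum :: "nat \<Rightarrow> ('i \<Rightarrow> complex mat) \<Rightarrow> 'i set \<Rightarrow> complex mat" where
  "mat_sum d f I = (\<Oplus>\<^bsub>module_mat TYPE(complex) d d\<^esub> i\<in>I. f i)"

text \<open>\<open>d\<close> is the size of the matrices \<open>A 1, \<dots>, A n\<close>; their tensor powers have size \<open>d ^ p\<close>.\<close>

definition S_sum :: "nat \<Rightarrow> (nat \<Rightarrow> complex mat) \<Rightarrow> nat \<Rightarrow> nat \<Rightarrow> nat \<Rightarrow> complex mat" where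
  "S_sum d A n p k =
     mat_sum (d ^ p) (\<lambda>I. kronecker_power (mat_sum d A I) p) {I. I \<subseteq> {1..n} \<and> card I = k}"

end

theory Submission
  imports Defs
begin

text \<open>
  For a finite set \<open>I\<close> of indices write \<open>A_J\<close> for the sum of the \<open>A i\<close> with \<open>i \<in> J\<close>, and let
  \<open>T p I\<close> be the sum of \<open>(-1) ^ (|I| + |J|) P p J\<close> over the subsets \<open>J\<close> of \<open>I\<close>, where \<open>P p J\<close> is the
  \<open>p\<close>-th Kronecker power of \<open>A_J\<close>. Sorting the subsets by cardinality shows that
  the difference of the two sides of the inequality is \<open>T p {1..n}\<close>; the empty subset, which has
  no counterpart in the inequality, contributes \<open>0\<close> because \<open>p \<ge> 1\<close>. So the claim is that
  \<open>T p I\<close> is positive semidefinite.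

  Expanding the tensor powers, inclusion and exclusion leaves in \<open>T p I\<close> exactly the products
  \<open>A (f 1) \<otimes> \<dots> \<otimes> A (f p)\<close> with \<open>f\<close> mapping onto \<open>I\<close>, and each of them is positive semidefinite.
  Surjections can be avoided by splitting off the first factor: as
  \<open>P (p + 1) J = (\<Sum>i\<in>J. A i \<otimes> P p J)\<close>, one has
  \<open>T (p + 1) I = (\<Sum>i\<in>I. A i \<otimes> (T p I + T p (I - {i})))\<close>, which is the Stirling recursion for
  surjections, according to whether the value \<open>f 1 = i\<close> is attained again or not
  (\<open>alt_sum_weighted\<close>). Its coefficients are nonnegative, and \<open>T 0 I\<close> is \<open>1\<close> or \<open>0\<close>, so induction
  on \<open>p\<close> gives the result (\<open>alternating_kronecker_powers_psd\<close>).

  The only analytic ingredient is that Kronecker products of positive semidefinite matrices are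
  positive semidefinite. In terms of entries, a Kronecker product is the entrywise product of two
  matrices obtained by repeating indices along \<open>div\<close> and \<open>mod\<close>
  (\<open>psd_kernel_kronecker\<close>). Repeating indices preserves positivity (\<open>psd_kernel_pullback\<close>), and
  so does the entrywise product, by Schur's theorem (\<open>psd_kernel_schur_product\<close>).
\<close>

section \<open>Positive semidefinite kernels\<close>

text \<open>Entrywise formulation of positive semidefiniteness over an arbitrary index set: the Schur
  complement below removes a single index, which is awkward for matrices indexed by initial
  segments of the naturals.\<close>

definition psd_kernel :: "'a set \<Rightarrow> ('a \<Rightarrow> 'a \<Rightarrow> complex) \<Rightarrow> bool" where
  "psd_kernel S K \<longleftrightarrow> (\<forall>i\<in>S. \<forall>j\<in>S. K j i = cnj (K i j)) \<and>
     (\<forall>v. 0 \<le> (\<Sum>i\<in>S. \<Sum>j\<in>S. cnj (v i) * K i j * v j))"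

lemma psd_kernel_hermitian: "psd_kernel S K \<Longrightarrow> i \<in> S \<Longrightarrow> j \<in> S \<Longrightarrow> K j i = cnj (K i j)"
  unfolding psd_kernel_def by blast

lemma psd_kernel_form_nonneg:
  "psd_kernel S K \<Longrightarrow> 0 \<le> (\<Sum>i\<in>S. \<Sum>j\<in>S. cnj (v i) * K i j * v j)"
  unfolding psd_kernel_def by blast

lemma psd_kernel_cong:
  assumes "\<And>i j. i \<in> S \<Longrightarrow> j \<in> S \<Longrightarrow> K i j = L i j"
  shows "psd_kernel S K \<longleftrightarrow> psd_kernel S L"
proof -
  have "(\<Sum>i\<in>S. \<Sum>j\<in>S. cnj (v i) * K i j * v j) = (\<Sum>i\<in>S. \<Sum>j\<in>S. cnj (v i) * L i j * v j)" for v
    by (intro sum.cong refl) (simp add: assms)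
  then show ?thesis
    using assms by (simp add: psd_kernel_def)
qed

lemma psd_kernel_sum:
  assumes "\<And>k. k \<in> T \<Longrightarrow> psd_kernel S (K k)"
  shows "psd_kernel S (\<lambda>i j. \<Sum>k\<in>T. K k i j)"
  unfolding psd_kernel_def
proof (intro conjI ballI allI)
  fix i j assume "i \<in> S" "j \<in> S"
  then show "(\<Sum>k\<in>T. K k j i) = cnj (\<Sum>k\<in>T. K k i j)"
    unfolding cnj_sum by (intro sum.cong refl psd_kernel_hermitian[OF assms])
next
  fix v
  have "(\<Sum>i\<in>S. \<Sum>j\<in>S. cnj (v i) * (\<Sum>k\<in>T. K k i j) * v j)
      = (\<Sum>k\<in>T. \<Sum>i\<in>S. \<Sum>j\<in>S. cnj (v i) * K k i j * v j)"
    unfolding sum_distrib_left sum_distrib_right sum.swap[of _ T S] ..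
  then show "0 \<le> (\<Sum>i\<in>S. \<Sum>j\<in>S. cnj (v i) * (\<Sum>k\<in>T. K k i j) * v j)"
    using psd_kernel_form_nonneg[OF assms] by (simp add: sum_nonneg)
qed

lemma psd_kernel_add:
  assumes "psd_kernel S K" "psd_kernel S L"
  shows "psd_kernel S (\<lambda>i j. K i j + L i j)"
proof -
  have "psd_kernel S (\<lambda>i j. \<Sum>b\<in>(UNIV :: bool set). (if b then K else L) i j)"
    by (rule psd_kernel_sum) (use assms in auto)
  then show ?thesis
    by (simp add: UNIV_bool add.commute)
qed

text \<open>The form of the pulled back kernel at \<open>v\<close> is the form of \<open>K\<close> at the pushforward of \<open>v\<close>, which
  adds up \<open>v\<close> over each fibre of \<open>f\<close>.\<close>

lemma psd_kernel_pullback: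
  fixes f :: "'b \<Rightarrow> 'a"
  assumes K: "psd_kernel S K" and S: "finite S" and R: "finite R" and f: "f ` R \<subseteq> S"
  shows "psd_kernel R (\<lambda>r s. K (f r) (f s))"
  unfolding psd_kernel_def
proof (intro conjI ballI allI)
  fix r s assume "r \<in> R" "s \<in> R"
  then show "K (f s) (f r) = cnj (K (f r) (f s))"
    using f by (intro psd_kernel_hermitian[OF K]) auto
next
  fix v :: "'b \<Rightarrow> complex"
  define w :: "'a \<Rightarrow> complex" where "w i = (\<Sum>r\<in>{r \<in> R. f r = i}. v r)" for i
  have cell: "cnj (w i) * K i j * w j
      = (\<Sum>r\<in>{r \<in> R. f r = i}. \<Sum>s\<in>{s \<in> R. f s = j}. cnj (v r) * K (f r) (f s) * v s)" for i j
    unfolding w_def cnj_sum sum_distrib_right unfolding sum_distrib_left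
    by (intro sum.cong refl) auto
  have "(\<Sum>i\<in>S. \<Sum>j\<in>S. cnj (w i) * K i j * w j)
      = (\<Sum>i\<in>S. \<Sum>r\<in>{r \<in> R. f r = i}. \<Sum>j\<in>S. \<Sum>s\<in>{s \<in> R. f s = j}. cnj (v r) * K (f r) (f s) * v s)"
    unfolding cell by (rule sum.cong[OF refl], rule sum.swap)
  also have "\<dots> = (\<Sum>r\<in>R. \<Sum>s\<in>R. cnj (v r) * K (f r) (f s) * v s)"
    by (simp only: sum.group[OF R S f])
  finally show "0 \<le> (\<Sum>r\<in>R. \<Sum>s\<in>R. cnj (v r) * K (f r) (f s) * v s)"
    using psd_kernel_form_nonneg[OF K, of w] by simp
qed

text \<open>Since \<open>y / 0 = 0\<close>, the Schur complement formula also makes sense when the pivot \<open>K x x\<close>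
  vanishes. Then the whole row of \<open>x\<close> vanishes too, so nothing is lost.\<close>

lemma psd_kernel_schur_complement:
  assumes K: "psd_kernel (insert x S) K" and S: "finite S" "x \<notin> S"
  shows "0 \<le> K x x"
    and "\<And>j. j \<in> S \<Longrightarrow> K x x = 0 \<Longrightarrow> K x j = 0"
    and "psd_kernel S (\<lambda>i j. K i j - K i x * K x j / K x x)"
proof -
  have xx: "K x x = of_real (Re (K x x))"
    using psd_kernel_hermitian[OF K, of x x] by (metis Reals_cnj_iff insertI1 of_real_Re)
  have Kx: "K i x = cnj (K x i)" if "i \<in> S" for i
    using psd_kernel_hermitian[OF K] that by blast
  define b where "b v = (\<Sum>j\<in>S. K x j * v j)" for v
  define Q where "Q v = (\<Sum>i\<in>S. \<Sum>j\<in>S. cnj (v i) * K i j * v j)" for v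
  have cnj_b: "cnj (b v) = (\<Sum>i\<in>S. cnj (v i) * K i x)" for v
    by (auto simp: b_def Kx mult.commute intro!: sum.cong)
  (* the form of K at the vector that is t at x and v on S *)
  have form: "0 \<le> cnj t * K x x * t + cnj t * b v + cnj (b v) * t + Q v" for t v
  proof -
    let ?v = "v(x := t)"
    have off: "(\<Sum>i\<in>S. h i (?v i)) = (\<Sum>i\<in>S. h i (v i))" for h :: "'a \<Rightarrow> complex \<Rightarrow> complex"
      using S(2) by (intro sum.cong) auto
    have cross: "cnj t * b v = (\<Sum>j\<in>S. cnj t * K x j * v j)"
        "cnj (b v) * t = (\<Sum>i\<in>S. cnj (v i) * K i x * t)"
      by (simp_all only: cnj_b sum_distrib_right) (simp add: b_def sum_distrib_left mult.assoc)
    have "(\<Sum>i\<in>insert x S. \<Sum>j\<in>insert x S. cnj (?v i) * K i j * ?v j)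
        = cnj t * K x x * t + cnj t * b v + cnj (b v) * t + Q v"
      using S off[of "\<lambda>i y. cnj t * K x i * y"] off[of "\<lambda>i y. cnj y * K i x * t"]
        off[of "\<lambda>i y. \<Sum>j\<in>S. cnj y * K i j * ?v j"] off[of "\<lambda>j y. cnj (v i) * K i j * y" for i]
      by (simp add: sum.distrib cross Q_def mult.assoc)
    then show ?thesis
      using psd_kernel_form_nonneg[OF K, of ?v] by simp
  qed
  show a: "0 \<le> K x x"
    using form[of 1 "\<lambda>_. 0"] by (simp add: b_def Q_def)
  (* with a zero pivot the form is affine in t along the direction - b v, hence unbounded below
     unless b v = 0; s is chosen just past the point where its real part becomes negative *)
  have b0: "b v = 0" if "K x x = 0" for v
  proof (rule ccontr)
    assume "b v \<noteq> 0"
    define m where "m = (cmod (b v))\<^sup>2"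
    have m: "m > 0" using \<open>b v \<noteq> 0\<close> by (simp add: m_def)
    have sq: "cnj (b v) * b v = of_real m"
      unfolding m_def complex_norm_square by (rule mult.commute)
    define s where "s = (\<bar>Re (Q v)\<bar> + 1) / (2 * m)"
    have "0 \<le> - of_real s * (cnj (b v) * b v) - of_real s * (cnj (b v) * b v) + Q v"
      using form[of "- of_real s * b v" v] that by (simp add: algebra_simps)
    then have "0 \<le> - 2 * (s * m) + Re (Q v)"
      unfolding sq by (simp add: less_eq_complex_def mult.commute)
    moreover have "2 * (s * m) = \<bar>Re (Q v)\<bar> + 1"
      using m by (simp add: s_def)
    ultimately show False by linarith
  qed
  show "K x j = 0" if "j \<in> S" "K x x = 0" for j
  proof -
    have "b (\<lambda>i. if i = j then 1 else 0) = K x j"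
      using S that by (simp add: b_def if_distrib sum.delta cong: if_cong)
    then show ?thesis using b0[OF that(2)] by metis
  qed
  show "psd_kernel S (\<lambda>i j. K i j - K i x * K x j / K x x)"
    unfolding psd_kernel_def
  proof (intro conjI ballI allI)
    fix i j assume "i \<in> S" "j \<in> S"
    moreover have "cnj (K x x) = K x x" by (subst (1 2) xx) simp
    ultimately show "K j i - K j x * K x i / K x x = cnj (K i j - K i x * K x j / K x x)"
      using psd_kernel_hermitian[OF K, of i j] Kx by simp
  next
    fix v
    have "cnj (b v) * b v / K x x = (\<Sum>i\<in>S. \<Sum>j\<in>S. cnj (v i) * (K i x * K x j / K x x) * v j)"
      unfolding cnj_b unfolding b_def sum_product sum_divide_distrib by (simp add: mult_ac)
    then have "(\<Sum>i\<in>S. \<Sum>j\<in>S. cnj (v i) * (K i j - K i x * K x j / K x x) * v j)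
        = Q v - cnj (b v) * b v / K x x"
      by (simp only: Q_def right_diff_distrib left_diff_distrib sum_subtractf)
    also have "0 \<le> \<dots>"
    proof (cases "K x x = 0")
      case True
      then show ?thesis using form[of 0 v] by simp
    next
      case False
      have "cnj (K x x) = K x x" by (subst (1 2) xx) simp
      (* t = - b v / K x x minimises the form over t *)
      then show ?thesis
        using False form[of "- b v / K x x" v] by (simp add: field_simps)
    qed
    finally show "0 \<le> (\<Sum>i\<in>S. \<Sum>j\<in>S. cnj (v i) * (K i j - K i x * K x j / K x x) * v j)" .
  qed
qed

text \<open>Cholesky decomposition: eliminating \<open>x\<close> splits off the rank one kernel
  \<open>K i x * K x j / K x x\<close> and leaves the Schur complement on the other indices.\<close>

lemma psd_kernel_rank_one_decomposition:
  assumes "finite S" "psd_kernel S K"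
  shows "\<exists>c. \<forall>i\<in>S. \<forall>j\<in>S. K i j = (\<Sum>k\<in>S. c k i * cnj (c k j))"
  using assms
proof (induction S arbitrary: K rule: finite_induct)
  case empty
  then show ?case by simp
next
  case (insert x S)
  note sc = psd_kernel_schur_complement[OF insert.prems insert.hyps]
  obtain c where c: "\<forall>i\<in>S. \<forall>j\<in>S. K i j - K i x * K x j / K x x = (\<Sum>k\<in>S. c k i * cnj (c k j))"
    using insert.IH[OF sc(3)] by blast
  define a where "a = Re (K x x)"
  have a: "K x x = of_real a" "a \<ge> 0"
    using sc(1) by (auto simp: a_def less_eq_complex_def complex_eq_iff)
  have herm: "K i x = cnj (K x i)" if "i \<in> insert x S" for i
    using psd_kernel_hermitian[OF insert.prems] that by blast
  (* the vectors of the Schur complement are extended by 0 at the eliminated index x *)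
  define e where "e k i = (if k = x then K i x / of_real (sqrt a) else if i = x then 0 else c k i)" for k i
  have ex: "e x i * cnj (e x j) = K i x * K x j / K x x" if "j \<in> insert x S" for i j
    using herm[OF that] a by (simp add: e_def flip: of_real_mult)
  have rest: "(\<Sum>k\<in>S. e k i * cnj (e k j)) = (if i = x \<or> j = x then 0 else \<Sum>k\<in>S. c k i * cnj (c k j))" for i j
    using insert.hyps by (auto simp: e_def intro!: sum.neutral sum.cong)
  have zero: "K x j = 0" "K j x = 0" if "j \<in> S" "K x x = 0" for j
    using sc(2)[OF that] herm[of j] that by auto
  have "K i j = (\<Sum>k\<in>insert x S. e k i * cnj (e k j))" if "i \<in> insert x S" "j \<in> insert x S" for i j
  proof -
    have "(\<Sum>k\<in>insert x S. e k i * cnj (e k j))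
       = K i x * K x j / K x x + (if i = x \<or> j = x then 0 else \<Sum>k\<in>S. c k i * cnj (c k j))"
      using insert.hyps ex[OF that(2)] rest by simp
    also have "\<dots> = K i j"
      using that c zero by (cases "K x x = 0") (auto simp: algebra_simps)
    finally show ?thesis by simp
  qed
  then show ?case by blast
qed

text \<open>Schur's product theorem: multiplying \<open>L\<close> entrywise by a rank one kernel \<open>c i * cnj (c j)\<close>
  only rescales the vector in the quadratic form of \<open>L\<close>, and \<open>K\<close> is a sum of such rank one
  kernels.\<close>

lemma psd_kernel_schur_product:
  assumes S: "finite S" and K: "psd_kernel S K" and L: "psd_kernel S L"
  shows "psd_kernel S (\<lambda>i j. K i j * L i j)"
  unfolding psd_kernel_def
proof (intro conjI ballI allI)
  fix i j assume "i \<in> S" "j \<in> S"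
  then show "K j i * L j i = cnj (K i j * L i j)"
    using psd_kernel_hermitian[OF K, of i j] psd_kernel_hermitian[OF L, of i j] by simp
next
  fix v
  obtain c where c: "\<forall>i\<in>S. \<forall>j\<in>S. K i j = (\<Sum>k\<in>S. c k i * cnj (c k j))"
    using psd_kernel_rank_one_decomposition[OF S K] by blast
  have "(\<Sum>i\<in>S. \<Sum>j\<in>S. cnj (v i) * (K i j * L i j) * v j)
      = (\<Sum>i\<in>S. \<Sum>j\<in>S. \<Sum>k\<in>S. cnj (cnj (c k i) * v i) * L i j * (cnj (c k j) * v j))"
    by (intro sum.cong refl) (simp add: c sum_distrib_left sum_distrib_right mult_ac)
  also have "\<dots> = (\<Sum>i\<in>S. \<Sum>k\<in>S. \<Sum>j\<in>S. cnj (cnj (c k i) * v i) * L i j * (cnj (c k j) * v j))"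
    by (rule sum.cong[OF refl], rule sum.swap)
  also have "\<dots> = (\<Sum>k\<in>S. \<Sum>i\<in>S. \<Sum>j\<in>S. cnj (cnj (c k i) * v i) * L i j * (cnj (c k j) * v j))"
    by (rule sum.swap)
  also have "0 \<le> \<dots>"
    by (rule sum_nonneg, rule psd_kernel_form_nonneg[OF L])
  finally show "0 \<le> (\<Sum>i\<in>S. \<Sum>j\<in>S. cnj (v i) * (K i j * L i j) * v j)" .
qed

lemma psd_kernel_kronecker:
  fixes m q :: nat
  assumes K: "psd_kernel {..<m} K" and L: "psd_kernel {..<q} L"
  shows "psd_kernel {..<m * q} (\<lambda>r c. K (r div q) (c div q) * L (r mod q) (c mod q))"
proof (rule psd_kernel_schur_product)
  show "psd_kernel {..<m * q} (\<lambda>r c. K (r div q) (c div q))"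
    by (rule psd_kernel_pullback[OF K]) (auto simp: less_mult_imp_div_less)
  show "psd_kernel {..<m * q} (\<lambda>r c. L (r mod q) (c mod q))"
    by (rule psd_kernel_pullback[OF L]) (auto intro!: mod_less_divisor gr0I)
qed simp

section \<open>Alternating sums over subsets\<close>

text \<open>The Moebius transform of \<open>F\<close> on the subset lattice, with the exponent \<open>card I + card J\<close> in place
  of \<open>card I - card J\<close> to avoid truncated subtraction.\<close>

definition alt_sum :: "'i set \<Rightarrow> ('i set \<Rightarrow> complex) \<Rightarrow> complex" where
  "alt_sum I F = (\<Sum>J\<in>Pow I. (-1) ^ (card I + card J) * F J)"

text \<open>The subsets avoiding \<open>i\<close> are the subsets of \<open>I - {i}\<close>; seen from that smaller set their signs are
  reversed, so removing them from \<open>alt_sum I F\<close> adds \<open>alt_sum (I - {i}) F\<close>.\<close>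

lemma alt_sum_containing:
  assumes "finite I" "i \<in> I"
  shows "(\<Sum>J\<in>{J \<in> Pow I. i \<in> J}. (-1) ^ (card I + card J) * F J)
       = alt_sum I F + alt_sum (I - {i}) F"
proof -
  let ?t = "\<lambda>J. (-1) ^ (card I + card J) * F J"
  have split: "Pow I = {J \<in> Pow I. i \<in> J} \<union> Pow (I - {i})" by auto
  have "alt_sum I F = sum ?t {J \<in> Pow I. i \<in> J} + sum ?t (Pow (I - {i}))"
    unfolding alt_sum_def using assms(1)
    by (subst split, intro sum.union_disjoint) auto
  moreover have "sum ?t (Pow (I - {i})) = - alt_sum (I - {i}) F"
    unfolding alt_sum_def card.remove[OF assms] by (simp add: sum_negf)
  ultimately show ?thesis by simp
qed

text \<open>Exchanging the two summations fixes \<open>i\<close> and leaves the subsets \<open>J\<close> containing \<open>i\<close>. This is the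
  recursion that replaces a count of surjections.\<close>

lemma alt_sum_weighted:
  assumes I: "finite I"
  shows "alt_sum I (\<lambda>J. (\<Sum>i\<in>J. a i) * F J) = (\<Sum>i\<in>I. a i * (alt_sum I F + alt_sum (I - {i}) F))"
proof -
  have "alt_sum I (\<lambda>J. (\<Sum>i\<in>J. a i) * F J)
      = (\<Sum>J\<in>Pow I. \<Sum>i\<in>{i \<in> I. i \<in> J}. a i * ((-1) ^ (card I + card J) * F J))"
    unfolding alt_sum_def
  proof (rule sum.cong[OF refl])
    fix J assume "J \<in> Pow I"
    then have "{i \<in> I. i \<in> J} = J" by auto
    then show "(-1) ^ (card I + card J) * ((\<Sum>i\<in>J. a i) * F J)
        = (\<Sum>i\<in>{i \<in> I. i \<in> J}. a i * ((-1) ^ (card I + card J) * F J))"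
      by (simp add: sum_distrib_left sum_distrib_right mult_ac)
  qed
  also have "\<dots> = (\<Sum>i\<in>I. \<Sum>J\<in>{J \<in> Pow I. i \<in> J}. a i * ((-1) ^ (card I + card J) * F J))"
    using I by (intro sum.swap_restrict) auto
  also have "\<dots> = (\<Sum>i\<in>I. a i * (alt_sum I F + alt_sum (I - {i}) F))"
    by (intro sum.cong refl) (simp only: alt_sum_containing[OF I] flip: sum_distrib_left)
  finally show ?thesis .
qed

lemma alt_sum_one: "finite I \<Longrightarrow> alt_sum I (\<lambda>J. 1) = (if I = {} then 1 else 0)"
proof (induction I rule: finite_induct)
  case empty
  then show ?case by (simp add: alt_sum_def)
next
  case (insert x I)
  have "inj_on (insert x) (Pow I)" "Pow I \<inter> insert x ` Pow I = {}"
    using insert.hyps by (auto simp: inj_on_def)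
  moreover have "card (insert x J) = Suc (card J)" if "J \<in> Pow I" for J
    using that insert.hyps by (subst card_insert_disjoint) (auto intro: finite_subset)
  ultimately show ?case
    using insert.hyps
    by (simp add: alt_sum_def Pow_insert sum.union_disjoint sum.reindex sum_negf)
qed

text \<open>All subsets with \<open>k\<close> elements carry the same sign, positive exactly when \<open>k\<close> has the parity of
  \<open>n\<close>. The hypothesis on \<open>F {}\<close> disposes of the class \<open>k = 0\<close>, which occurs on neither side.\<close>

lemma alt_sum_by_card:
  assumes I: "finite I" and n: "card I = n" "n \<ge> 1" and F: "F {} = 0"
  shows "alt_sum I F
    = (\<Sum>k\<in>{k \<in> {1..n}. k mod 2 = n mod 2}. \<Sum>J\<in>{J. J \<subseteq> I \<and> card J = k}. F J)
    - (\<Sum>k\<in>{k \<in> {1..n - 1}. k mod 2 = (n - 1) mod 2}. \<Sum>J\<in>{J. J \<subseteq> I \<and> card J = k}. F J)"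
proof -
  define E where "E k = (\<Sum>J\<in>{J. J \<subseteq> I \<and> card J = k}. F J)" for k
  obtain n' where n': "n = Suc n'"
    using n(2) by (cases n) auto
  let ?X = "{k \<in> {1..n}. k mod 2 = n mod 2}" and ?Y = "{k \<in> {1..n - 1}. k mod 2 = (n - 1) mod 2}"
  have parity: "k mod 2 = (n - 1) mod 2 \<longleftrightarrow> k mod 2 \<noteq> n mod 2" for k
    unfolding n' diff_Suc_1 by presburger
  have "{J. J \<subseteq> I \<and> card J = 0} = {{}}"
    using I by (auto dest: finite_subset)
  then have E0: "E 0 = 0" by (simp add: E_def F)
  have "alt_sum I F
      = (\<Sum>k\<in>{..n}. \<Sum>J\<in>{J \<in> Pow I. card J = k}. (-1) ^ (n + card J) * F J)"
    unfolding alt_sum_def n(1)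
    by (rule sum.group[symmetric]) (use I n(1) in \<open>auto intro: card_mono\<close>)
  also have "\<dots> = (\<Sum>k\<in>{..n}. (-1) ^ (n + k) * E k)"
    by (intro sum.cong[OF refl]) (auto simp: E_def sum_distrib_left intro!: sum.cong)
  also have "\<dots> = (\<Sum>k\<in>?X \<union> ?Y. (-1) ^ (n + k) * E k)"
  proof (rule sum.mono_neutral_right)
    show "\<forall>k\<in>{..n} - (?X \<union> ?Y). (-1) ^ (n + k) * E k = 0"
    proof
      fix k assume k: "k \<in> {..n} - (?X \<union> ?Y)"
      have "k = 0"
      proof (rule ccontr)
        assume "k \<noteq> 0"
        with k have "k mod 2 \<noteq> n mod 2" "1 \<le> k" "k \<le> n" by auto
        moreover from this have "k \<noteq> n" by auto
        ultimately have "k \<in> {1..n - 1}" "k mod 2 = (n - 1) mod 2"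
          unfolding parity by simp_all
        then have "k \<in> ?Y" by blast
        with k show False by blast
      qed
      then show "(-1) ^ (n + k) * E k = 0" by (simp add: E0)
    qed
  qed auto
  also have "\<dots> = (\<Sum>k\<in>?X. (-1) ^ (n + k) * E k) + (\<Sum>k\<in>?Y. (-1) ^ (n + k) * E k)"
  proof (rule sum.union_disjoint)
    show "?X \<inter> ?Y = {}" using parity by blast
  qed simp_all
  also have "(\<Sum>k\<in>?X. (-1) ^ (n + k) * E k) = (\<Sum>k\<in>?X. E k)"
  proof (rule sum.cong[OF refl])
    fix k assume "k \<in> ?X"
    then have "k mod 2 = n mod 2" by blast
    then have "even (n + k)" by presburger
    then show "(-1) ^ (n + k) * E k = E k" by simp
  qed
  also have "(\<Sum>k\<in>?Y. (-1) ^ (n + k) * E k) = - (\<Sum>k\<in>?Y. E k)"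
    unfolding sum_negf[symmetric]
  proof (rule sum.cong[OF refl])
    fix k assume "k \<in> ?Y"
    then have "k mod 2 \<noteq> n mod 2" using parity by blast
    then have "odd (n + k)" by presburger
    then show "(-1) ^ (n + k) * E k = - E k" by simp
  qed
  finally show ?thesis by (simp add: E_def)
qed

section \<open>Matrices as kernels\<close>

lemma mat_sum_carrier:
  assumes "\<And>i. i \<in> I \<Longrightarrow> f i \<in> carrier_mat d d"
  shows "mat_sum d f I \<in> carrier_mat d d"
proof -
  interpret abelian_group "module_mat TYPE(complex) d d" by (rule abelian_group_mat)
  show ?thesis
    using finsum_closed[of f I] assms unfolding mat_sum_def by (auto simp: module_mat_simps)
qed

lemma index_mat_sum:
  assumes "finite I" "\<And>i. i \<in> I \<Longrightarrow> f i \<in> carrier_mat d d" "r < d" "c < d"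
  shows "mat_sum d f I $$ (r, c) = (\<Sum>i\<in>I. f i $$ (r, c))"
  using assms(1,2)
proof (induction I rule: finite_induct)
  interpret abelian_group "module_mat TYPE(complex) d d" by (rule abelian_group_mat)
  case empty
  then show ?case using assms(3,4) by (simp add: mat_sum_def module_mat_simps)
next
  interpret abelian_group "module_mat TYPE(complex) d d" by (rule abelian_group_mat)
  case (insert x I)
  have "mat_sum d f (insert x I) = f x + mat_sum d f I"
    unfolding mat_sum_def using insert
    by (subst finsum_insert) (auto simp: module_mat_simps)
  then show ?case
    using insert mat_sum_carrier[of I f d] assms(3,4) by simp
qed

lemma kronecker_power_carrier:
  "A \<in> carrier_mat d d \<Longrightarrow> kronecker_power A p \<in> carrier_mat (d ^ p) (d ^ p)"
  by (induction p) (auto simp: kronecker_def)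

lemma index_kronecker_power_Suc:
  assumes "A \<in> carrier_mat d d" "r < d ^ Suc p" "c < d ^ Suc p"
  shows "kronecker_power A (Suc p) $$ (r, c)
    = A $$ (r div d ^ p, c div d ^ p) * kronecker_power A p $$ (r mod d ^ p, c mod d ^ p)"
  using assms kronecker_power_carrier[OF assms(1), of p] by (auto simp: kronecker_def)

lemma psd_mat_iff_psd_kernel:
  assumes M: "M \<in> carrier_mat m m"
  shows "psd_mat M \<longleftrightarrow> psd_kernel {..<m} (\<lambda>r c. M $$ (r, c))"
proof -
  have herm: "hermitian_mat M \<longleftrightarrow> (\<forall>i<m. \<forall>j<m. M $$ (j, i) = cnj (M $$ (i, j)))"
  proof -
    have adj: "mat_adjoint M $$ (i, j) = cnj (M $$ (j, i))" if "i < m" "j < m" for i j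
      using that M by (simp add: mat_adjoint_def mat_of_rows_index)
    have car: "mat_adjoint M \<in> carrier_mat m m"
      using M by (auto simp: mat_adjoint_def)
    have "mat_adjoint M = M \<longleftrightarrow> (\<forall>i<m. \<forall>j<m. mat_adjoint M $$ (i, j) = M $$ (i, j))"
      using M car by (auto simp: mat_eq_iff)
    also have "\<dots> \<longleftrightarrow> (\<forall>i<m. \<forall>j<m. cnj (M $$ (j, i)) = M $$ (i, j))"
      using adj by simp
    also have "\<dots> \<longleftrightarrow> (\<forall>i<m. \<forall>j<m. M $$ (j, i) = cnj (M $$ (i, j)))"
      by metis
    finally show ?thesis
      using M by (simp add: hermitian_mat_def)
  qed
  have form: "(M *\<^sub>v v) \<bullet>c v = (\<Sum>i<m. \<Sum>j<m. cnj (v $ i) * M $$ (i, j) * v $ j)"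
    if v: "v \<in> carrier_vec m" for v
  proof -
    have "(M *\<^sub>v v) $ i = (\<Sum>j<m. M $$ (i, j) * v $ j)" if "i < m" for i
      using that v M by (simp add: scalar_prod_def atLeast0LessThan)
    then have "(M *\<^sub>v v) \<bullet>c v = (\<Sum>i<m. (\<Sum>j<m. M $$ (i, j) * v $ j) * cnj (v $ i))"
      using v M by (simp add: scalar_prod_def atLeast0LessThan)
    then show ?thesis
      by (simp add: sum_distrib_left mult_ac)
  qed
  have "(\<forall>v\<in>carrier_vec m. 0 \<le> (M *\<^sub>v v) \<bullet>c v)
      \<longleftrightarrow> (\<forall>w. 0 \<le> (\<Sum>i<m. \<Sum>j<m. cnj (w i) * M $$ (i, j) * w j))"
  proof (intro iffI allI ballI)
    fix w :: "nat \<Rightarrow> complex"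
    assume "\<forall>v\<in>carrier_vec m. 0 \<le> (M *\<^sub>v v) \<bullet>c v"
    then have "0 \<le> (M *\<^sub>v vec m w) \<bullet>c vec m w" by simp
    then show "0 \<le> (\<Sum>i<m. \<Sum>j<m. cnj (w i) * M $$ (i, j) * w j)"
      by (simp add: form)
  qed (simp add: form)
  then show ?thesis
    using M herm unfolding psd_mat_def psd_kernel_def by auto
qed

section \<open>Positivity of alternating sums of Kronecker powers\<close>

text \<open>Induction on \<open>p\<close>, for all index sets at once because the step for \<open>I\<close> also uses \<open>I - {i}\<close>.
  For \<open>p = 0\<close> all powers are \<open>1\<close>, and the alternating sum is \<open>1\<close> or \<open>0\<close>.\<close>

lemma alternating_kronecker_powers_psd:
  assumes "finite I" "\<And>i. i \<in> I \<Longrightarrow> A i \<in> carrier_mat d d" "\<And>i. i \<in> I \<Longrightarrow> psd_mat (A i)"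
  shows "psd_kernel {..<d ^ p}
    (\<lambda>r c. alt_sum I (\<lambda>J. kronecker_power (mat_sum d A J) p $$ (r, c)))"
  using assms
proof (induction p arbitrary: I)
  case 0
  have "psd_kernel {..<d ^ 0} (\<lambda>r c. if I = {} then 1 else 0)"
    by (auto simp: psd_kernel_def lessThan_Suc mult.commute conjugate_square_positive[where ?'a = complex, simplified])
  then show ?case
    using 0(1) by (subst psd_kernel_cong) (auto simp: alt_sum_one)
next
  case (Suc p)
  let ?P = "\<lambda>p J r c. kronecker_power (mat_sum d A J) p $$ (r, c)"
  let ?q = "d ^ p"
  let ?B = "\<lambda>i r c. alt_sum I (\<lambda>J. ?P p J r c) + alt_sum (I - {i}) (\<lambda>J. ?P p J r c)"
  have div: "r div ?q < d" "r mod ?q < ?q" if "r < d ^ Suc p" for r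
    using that by (auto simp: less_mult_imp_div_less intro!: mod_less_divisor gr0I)
  have "psd_kernel {..<d ^ Suc p} (\<lambda>r c. A i $$ (r div ?q, c div ?q) * ?B i (r mod ?q) (c mod ?q))"
    if "i \<in> I" for i
  proof -
    have "psd_kernel {..<d} (\<lambda>r c. A i $$ (r, c))"
      using Suc.prems(2,3)[OF that] by (simp add: psd_mat_iff_psd_kernel)
    moreover have "psd_kernel {..<?q} (?B i)"
      using Suc by (intro psd_kernel_add Suc.IH) auto
    ultimately show ?thesis
      using psd_kernel_kronecker[where K = "\<lambda>r c. A i $$ (r, c)" and L = "?B i"] by simp
  qed
  then have "psd_kernel {..<d ^ Suc p}
      (\<lambda>r c. \<Sum>i\<in>I. A i $$ (r div ?q, c div ?q) * ?B i (r mod ?q) (c mod ?q))"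
    by (rule psd_kernel_sum)
  moreover have "alt_sum I (\<lambda>J. ?P (Suc p) J r c)
      = (\<Sum>i\<in>I. A i $$ (r div ?q, c div ?q) * ?B i (r mod ?q) (c mod ?q))"
    if "r < d ^ Suc p" "c < d ^ Suc p" for r c
  proof -
    have "?P (Suc p) J r c = (\<Sum>i\<in>J. A i $$ (r div ?q, c div ?q)) * ?P p J (r mod ?q) (c mod ?q)"
      if J: "J \<in> Pow I" for J
    proof -
      have A: "A i \<in> carrier_mat d d" if "i \<in> J" for i
        using J that Suc.prems(2) by auto
      have "finite J" using J Suc.prems(1) finite_subset by auto
      then have "mat_sum d A J $$ (r div ?q, c div ?q) = (\<Sum>i\<in>J. A i $$ (r div ?q, c div ?q))"
        using A div \<open>r < _\<close> \<open>c < _\<close> by (intro index_mat_sum)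
      with index_kronecker_power_Suc[OF mat_sum_carrier[of J A, OF A] \<open>r < _\<close> \<open>c < _\<close>]
      show ?thesis by (simp only:)
    qed
    then have "alt_sum I (\<lambda>J. ?P (Suc p) J r c)
        = alt_sum I (\<lambda>J. (\<Sum>i\<in>J. A i $$ (r div ?q, c div ?q)) * ?P p J (r mod ?q) (c mod ?q))"
      unfolding alt_sum_def by (intro sum.cong refl) (simp only:)
    then show ?thesis
      by (simp only: alt_sum_weighted[OF Suc.prems(1)])
  qed
  ultimately show ?case
    by (subst psd_kernel_cong) auto
qed

text \<open>The next two lemmas show that each side of the inequality is Hermitian, being even positive
  semidefinite.\<close>

lemma kronecker_power_psd:
  assumes "B \<in> carrier_mat d d" "psd_mat B"
  shows "psd_mat (kronecker_power B p)"
proof -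
  have "psd_kernel {..<d ^ p} (\<lambda>r c. kronecker_power B p $$ (r, c))"
  proof (induction p)
    case 0
    show ?case by (auto simp: psd_kernel_def lessThan_Suc less_eq_complex_def)
  next
    case (Suc p)
    have "psd_kernel {..<d} (\<lambda>r c. B $$ (r, c))"
      using assms by (simp add: psd_mat_iff_psd_kernel)
    from psd_kernel_kronecker[OF this Suc.IH]
    have "psd_kernel {..<d ^ Suc p}
        (\<lambda>r c. B $$ (r div d ^ p, c div d ^ p) * kronecker_power B p $$ (r mod d ^ p, c mod d ^ p))"
      by simp
    then show ?case
      by (rule psd_kernel_cong[THEN iffD1, rotated]) (simp only: index_kronecker_power_Suc[OF assms(1)] lessThan_iff)
  qed
  then show ?thesis
    using psd_mat_iff_psd_kernel[OF kronecker_power_carrier[OF assms(1)]] by simp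
qed

lemma mat_sum_psd:
  assumes "finite I" "\<And>i. i \<in> I \<Longrightarrow> f i \<in> carrier_mat m m" "\<And>i. i \<in> I \<Longrightarrow> psd_mat (f i)"
  shows "psd_mat (mat_sum m f I)"
proof -
  have "psd_kernel {..<m} (\<lambda>r c. \<Sum>i\<in>I. f i $$ (r, c))"
    using psd_mat_iff_psd_kernel[THEN iffD1, OF assms(2,3)] by (rule psd_kernel_sum)
  then have "psd_kernel {..<m} (\<lambda>r c. mat_sum m f I $$ (r, c))"
    by (rule psd_kernel_cong[THEN iffD1, rotated]) (simp add: index_mat_sum assms(1,2))
  then show ?thesis
    using psd_mat_iff_psd_kernel[OF mat_sum_carrier[of I f, OF assms(2)]] by simp
qed

theorem theorem3p3:
  fixes n p d :: nat and A :: "nat \<Rightarrow> complex mat"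
  assumes "n \<ge> 3" and "p \<ge> 1"
    and "\<And>i. i \<in> {1..n} \<Longrightarrow> A i \<in> carrier_mat d d"
    and "\<And>i. i \<in> {1..n} \<Longrightarrow> psd_mat (A i)"
  shows "loewner_ge
    (mat_sum (d ^ p) (S_sum d A n p) {k \<in> {1..n}. k mod 2 = n mod 2})
    (mat_sum (d ^ p) (S_sum d A n p) {k \<in> {1..n - 1}. k mod 2 = (n - 1) mod 2})"
proof -
  let ?m = "d ^ p" and ?P = "\<lambda>J. kronecker_power (mat_sum d A J) p"
  let ?X = "{k \<in> {1..n}. k mod 2 = n mod 2}" and ?Y = "{k \<in> {1..n - 1}. k mod 2 = (n - 1) mod 2}"
  have sum_car: "mat_sum d A J \<in> carrier_mat d d" if "J \<subseteq> {1..n}" for J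
    using that assms(3) by (intro mat_sum_carrier) auto
  have sum_psd: "psd_mat (mat_sum d A J)" if "J \<subseteq> {1..n}" for J
    using that assms(3,4) by (intro mat_sum_psd) (auto intro: finite_subset)
  note P_car = kronecker_power_carrier[OF sum_car]
    and P_psd = kronecker_power_psd[OF sum_car sum_psd]
  have fin: "finite {J. J \<subseteq> {1..n} \<and> card J = k}" for k
    by simp
  have S_car: "S_sum d A n p k \<in> carrier_mat ?m ?m" for k
    unfolding S_sum_def by (rule mat_sum_carrier) (simp add: P_car)
  have S_psd: "psd_mat (S_sum d A n p k)" for k
    unfolding S_sum_def by (rule mat_sum_psd[OF fin]) (simp_all add: P_car P_psd)
  have S_index: "S_sum d A n p k $$ (r, c) = (\<Sum>J\<in>{J. J \<subseteq> {1..n} \<and> card J = k}. ?P J $$ (r, c))"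
    if "r < ?m" "c < ?m" for k r c
    unfolding S_sum_def by (rule index_mat_sum[OF fin _ that]) (simp add: P_car)
  have side_car: "mat_sum ?m (S_sum d A n p) K \<in> carrier_mat ?m ?m" for K
    by (intro mat_sum_carrier S_car)
  have side_psd: "psd_mat (mat_sum ?m (S_sum d A n p) K)" if "finite K" for K
    using that by (intro mat_sum_psd S_car S_psd)
  have side_index: "mat_sum ?m (S_sum d A n p) K $$ (r, c)
      = (\<Sum>k\<in>K. \<Sum>J\<in>{J. J \<subseteq> {1..n} \<and> card J = k}. ?P J $$ (r, c))"
    if "finite K" "r < ?m" "c < ?m" for K r c
    using index_mat_sum[OF that(1) S_car that(2,3)] S_index[OF that(2,3)] by simp
  have empty: "?P {} $$ (r, c) = 0" if rc: "r < ?m" "c < ?m" for r c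
  proof -
    obtain p' where p': "p = Suc p'"
      using assms(2) by (cases p) auto
    have "mat_sum d A {} $$ (r div d ^ p', c div d ^ p') = 0"
      using rc unfolding p' by (subst index_mat_sum) (auto simp: less_mult_imp_div_less)
    then show ?thesis
      using index_kronecker_power_Suc[OF sum_car[of "{}"], of r p' c] rc unfolding p' by simp
  qed
  have diff: "(mat_sum ?m (S_sum d A n p) ?X - mat_sum ?m (S_sum d A n p) ?Y) $$ (r, c)
      = alt_sum {1..n} (\<lambda>J. ?P J $$ (r, c))" if rc: "r < ?m" "c < ?m" for r c
  proof -
    have "alt_sum {1..n} (\<lambda>J. ?P J $$ (r, c))
        = mat_sum ?m (S_sum d A n p) ?X $$ (r, c) - mat_sum ?m (S_sum d A n p) ?Y $$ (r, c)"
      using assms(1) empty[OF rc]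
      by (subst (1 2) side_index[OF _ rc], simp, simp, intro alt_sum_by_card) auto
    then show ?thesis
      using rc side_car[of ?X] side_car[of ?Y] by simp
  qed
  have "psd_kernel {..<?m} (\<lambda>r c. alt_sum {1..n} (\<lambda>J. ?P J $$ (r, c)))"
    using assms(3,4) by (intro alternating_kronecker_powers_psd) auto
  then have "psd_kernel {..<?m} (\<lambda>r c.
      (mat_sum ?m (S_sum d A n p) ?X - mat_sum ?m (S_sum d A n p) ?Y) $$ (r, c))"
    by (subst psd_kernel_cong[OF diff]) auto
  then have "psd_mat (mat_sum ?m (S_sum d A n p) ?X - mat_sum ?m (S_sum d A n p) ?Y)"
    using side_car[of ?X] side_car[of ?Y] by (subst psd_mat_iff_psd_kernel) auto
  moreover have "hermitian_mat (mat_sum ?m (S_sum d A n p) K)" if "finite K" for K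
    using side_psd[OF that] by (simp add: psd_mat_def)
  moreover have "dim_row (mat_sum ?m (S_sum d A n p) K) = ?m" for K
    using side_car[of K] by simp
  ultimately show ?thesis
    unfolding loewner_ge_def by simp
qed

end
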